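(* Let $f:\mathbb{N}\to\mathbb{N}$ and let $k,n\ge 0$ be integers. Put $p(n)=0$ if $n$ is even and $p(n)=1$ if $n$ is odd. Then $$\binom{k}{n}_{f} \equiv \begin{cases} 0 \pmod{2}, & \text{if } k \text{ is even and } n \text{ is odd};\\ \binom{k/2}{n/2}_{f} \pmod{2}, & \text{if } k \text{ is even and } n \text{ is even};\\ \sum_{s\ge 0} f(2s+p(n))\binom{\lfloor k/2\rfloor}{\lfloor n/2\rfloor-s}_{f}\pmod{2}, & \text{if } k \text{ is odd}.\end{cases}$$
   Context: $\mathbb{N}=\{0,1,2,\dots\}$. For a function $f:\mathbb{N}\to\mathbb{N}$ and integers $k,n\ge 0$, the extended binomial coefficient $\binom{k}{n}_{f}$ is the coefficient of $x^n$ in the formal power series $\bigl(\sum_{s\in\mathbb{N}} f(s)x^s\bigr)^k$; $\binom{k}{n}_f=0$ for $n<0$. *)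

theory Defs
  imports "HOL-Computational_Algebra.Formal_Power_Series" "HOL-Number_Theory.Cong"
begin

text \<open>The lower index is an integer, so that differences in it are not truncated;
  the coefficient vanishes at negative lower indices.\<close>

definition ext_binomial :: "(nat \<Rightarrow> nat) \<Rightarrow> nat \<Rightarrow> int \<Rightarrow> nat" where
  "ext_binomial f k n = (if n < 0 then 0 else fps_nth (Abs_fps f ^ k) (nat n))"

definition parity_ind :: "nat \<Rightarrow> nat" where
  "parity_ind n = (if even n then 0 else 1)"

text \<open>Series of the form used below have finite support, so \<^const>\<open>suminf\<close> is
  the ordinary sum of their nonzero terms.\<close>

lemma ext_binomial_series_finite_support:
  "finite {s. g s * ext_binomial f k (int m - int s) \<noteq> 0}"
  by (rule finite_subset[of _ "{..m}"]) (auto simp: ext_binomial_def split: if_splits)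

lemma ext_binomial_series_sums:
  "(\<lambda>s. g s * ext_binomial f k (int m - int s)) sums
     (\<Sum>s\<le>m. g s * ext_binomial f k (int m - int s))"
  by (rule sums_finite) (auto simp: ext_binomial_def)

end

theory Submission
  imports Defs
begin

text \<open>Over \<open>\<nat>\<close>, the square of a power series \<open>A(x)\<close> is congruent to \<open>A(x\<^sup>2)\<close> modulo 2:
  in the convolution for the coefficient of \<open>x\<^sup>n\<close> the terms with indices \<open>i\<close> and \<open>n - i\<close> agree, so only
  the middle one survives, and \<open>a\<^sup>2 \<equiv> a\<close>. Writing \<open>F\<^sup>k = (F\<^bsup>k div 2\<^esup>)\<^sup>2\<close> or
  \<open>F\<^sup>k = (F\<^bsup>k div 2\<^esup>)\<^sup>2 F\<close> gives the three cases.\<close>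

lemma sum_symmetric_cong_middle:
  fixes g :: "nat \<Rightarrow> nat"
  assumes sym: "\<And>i. i \<le> n \<Longrightarrow> g (n - i) = g i"
  shows "[(\<Sum>i\<le>n. g i) = (if even n then g (n div 2) else 0)] (mod 2)"
proof -
  \<comment> \<open>The reflection \<open>i \<mapsto> n - i\<close> exchanges \<open>L\<close> and
    \<open>U\<close>, so together they contribute twice the sum over \<open>L\<close>. The middle
    set \<open>M\<close> is empty when \<open>n\<close> is odd.\<close>
  define L where "L = {i. 2 * i < n}"
  define U where "U = {i. i \<le> n \<and> n < 2 * i}"
  define M where "M = {i. 2 * i = n}"
  have fin: "finite L" "finite U" "finite M"
    by (rule finite_subset[of _ "{..n}"]; auto simp: L_def U_def M_def)+
  have "{..n} = L \<union> U \<union> M"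
    by (auto simp: L_def U_def M_def)
  moreover have "L \<inter> U = {}" "(L \<union> U) \<inter> M = {}"
    by (auto simp: L_def U_def M_def)
  ultimately have "(\<Sum>i\<le>n. g i) = sum g L + sum g U + sum g M"
    using fin by (simp add: sum.union_disjoint)
  moreover have "sum g U = sum g L"
    by (rule sum.reindex_bij_witness[of _ "\<lambda>i. n - i" "\<lambda>i. n - i"])
      (auto simp: L_def U_def sym)
  moreover have "M = (if even n then {n div 2} else {})"
    by (auto simp: M_def)
  ultimately show ?thesis
    by (simp add: cong_def flip: mult_2)
qed

lemma fps_square_nth_cong_2:
  fixes A :: "nat fps"
  shows "[fps_nth (A\<^sup>2) n = (if even n then fps_nth A (n div 2) else 0)] (mod 2)"
proof -
  have "[fps_nth (A\<^sup>2) n =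
      (if even n then fps_nth A (n div 2) * fps_nth A (n - n div 2) else 0)] (mod 2)"
    unfolding power2_eq_square fps_mult_nth atLeast0AtMost
    by (rule sum_symmetric_cong_middle) (simp add: mult.commute)
  moreover have "n - n div 2 = n div 2" if "even n"
    using that by auto
  moreover have "[a * a = a] (mod 2)" for a :: nat
    by (simp add: cong_def mod2_eq_if)
  ultimately show ?thesis
    by (auto intro: cong_trans split: if_splits)
qed

text \<open>Used to drop the vanishing terms of a convolution in which one factor is supported on
  even exponents.\<close>

lemma sum_even_indices:
  fixes h :: "nat \<Rightarrow> 'a::comm_monoid_add"
  shows "(\<Sum>i\<le>n. if even i then h i else 0) = (\<Sum>j\<le>n div 2. h (2 * j))"
proof -
  have "(\<Sum>i\<le>n. if even i then h i else 0) = (\<Sum>i | i \<le> n \<and> even i. h i)"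
    by (simp flip: sum.inter_filter)
  also have "\<dots> = (\<Sum>j\<le>n div 2. h (2 * j))"
    by (rule sum.reindex_bij_witness[of _ "\<lambda>j. 2 * j" "\<lambda>i. i div 2"]) auto
  finally show ?thesis .
qed

text \<open>Modulo 2 the factor \<open>B\<^sup>2\<close> has only even exponents
  \<open>2 * j\<close>, each with coefficient \<open>fps_nth B j\<close>, so \<open>A\<close>
  contributes at \<open>n - 2 * j\<close>. Reversing the order by \<open>s = n div 2 - j\<close>
  turns this index into \<open>2 * s + parity_ind n\<close>.\<close>

lemma fps_square_mult_nth_cong_2:
  fixes A B :: "nat fps"
  shows "[fps_nth (B\<^sup>2 * A) n =
    (\<Sum>s\<le>n div 2. fps_nth A (2 * s + parity_ind n) * fps_nth B (n div 2 - s))] (mod 2)"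
proof -
  have "[fps_nth (B\<^sup>2 * A) n =
      (\<Sum>i\<le>n. (if even i then fps_nth B (i div 2) else 0) * fps_nth A (n - i))] (mod 2)"
    unfolding fps_mult_nth atLeast0AtMost
    by (intro cong_sum cong_mult fps_square_nth_cong_2 cong_refl)
  also have "(\<Sum>i\<le>n. (if even i then fps_nth B (i div 2) else 0) * fps_nth A (n - i)) =
      (\<Sum>i\<le>n. if even i then fps_nth B (i div 2) * fps_nth A (n - i) else 0)"
    by (intro sum.cong) auto
  also have "\<dots> = (\<Sum>j\<le>n div 2. fps_nth B j * fps_nth A (n - 2 * j))"
    by (simp add: sum_even_indices)
  also have "\<dots> =
      (\<Sum>s\<le>n div 2. fps_nth A (2 * s + parity_ind n) * fps_nth B (n div 2 - s))"
  proof (rule sum.reindex_bij_witness[of _ "\<lambda>s. n div 2 - s" "\<lambda>j. n div 2 - j"])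
    fix j assume "j \<in> {..n div 2}"
    \<comment> \<open>Division with remainder: \<open>parity_ind n\<close> is
      \<open>n mod 2\<close>. Since \<open>j \<le> n div 2\<close>, no subtraction below is
      truncated.\<close>
    moreover have "n = 2 * (n div 2) + parity_ind n"
      by (simp add: parity_ind_def)
    ultimately have "2 * (n div 2 - j) + parity_ind n = n - 2 * j" "n div 2 - (n div 2 - j) = j"
      by auto
    then show "fps_nth A (2 * (n div 2 - j) + parity_ind n) * fps_nth B (n div 2 - (n div 2 - j)) =
        fps_nth B j * fps_nth A (n - 2 * j)"
      by (simp add: mult.commute)
  qed auto
  finally show ?thesis .
qed


theorem theorem5:
  fixes f :: "nat \<Rightarrow> nat" and k n :: nat
  shows "(even k \<and> odd n \<longrightarrow> [ext_binomial f k (int n) = 0] (mod 2)) \<and>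
    (even k \<and> even n \<longrightarrow>
      [ext_binomial f k (int n) = ext_binomial f (k div 2) (int (n div 2))] (mod 2)) \<and>
    (odd k \<longrightarrow>
      [ext_binomial f k (int n) =
        (\<Sum>s. f (2 * s + parity_ind n) * ext_binomial f (k div 2) (int (n div 2) - int s))] (mod 2))"
proof -
  define B where "B = Abs_fps f ^ (k div 2)"
  have B: "ext_binomial f (k div 2) (int m) = fps_nth B m" for m
    by (simp add: ext_binomial_def B_def)
  have "ext_binomial f k (int n) = fps_nth (B\<^sup>2) n" if "even k"
    using that by (simp add: ext_binomial_def B_def flip: power_mult)
  with fps_square_nth_cong_2[of B n] have even_case:
    "[ext_binomial f k (int n) = (if even n then fps_nth B (n div 2) else 0)] (mod 2)" if "even k"
    using that by simp
  have odd_case: "[ext_binomial f k (int n) =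
      (\<Sum>s. f (2 * s + parity_ind n) * ext_binomial f (k div 2) (int (n div 2) - int s))] (mod 2)"
    if "odd k"
  proof -
    have "Abs_fps f ^ k = B\<^sup>2 * Abs_fps f"
      using that by (auto simp: B_def mult.commute elim!: oddE simp flip: power_mult)
    then have "ext_binomial f k (int n) = fps_nth (B\<^sup>2 * Abs_fps f) n"
      by (simp add: ext_binomial_def)
    \<comment> \<open>For \<open>s > n div 2\<close> the lower index is negative and
      \<open>ext_binomial\<close> is 0, so the series stops at \<open>n div 2\<close>.\<close>
    moreover have "(\<Sum>s. f (2 * s + parity_ind n) * ext_binomial f (k div 2) (int (n div 2) - int s)) =
        (\<Sum>s\<le>n div 2. f (2 * s + parity_ind n) * ext_binomial f (k div 2) (int (n div 2) - int s))"
      using ext_binomial_series_sums by (rule sums_unique[symmetric])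
    moreover have "\<dots> = (\<Sum>s\<le>n div 2. f (2 * s + parity_ind n) * fps_nth B (n div 2 - s))"
      \<comment> \<open>Within the range \<open>s \<le> n div 2\<close> the integer difference is
        the image of the natural one. Folding \<open>of_nat_diff\<close> backwards gives the form
        \<open>int m\<close> that \<open>B\<close> requires.\<close>
      by (intro sum.cong refl arg_cong2[of _ _ _ _ "(*)"])
        (simp add: B del: of_nat_diff flip: of_nat_diff)
    ultimately show ?thesis
      using fps_square_mult_nth_cong_2[of B "Abs_fps f" n] by simp
  qed
  show ?thesis
    using even_case odd_case by (simp only: B) auto
qed

end
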